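(* Let $0<q<1$, $M\in\mathbb N$, and $\vec k=(k_1,\dots,k_M)$ with all $k_j>0$. (i) The function $D:X_d\times X_d\to\mathbb R$, $$D(\eta,\xi)=\prod_{j=1}^M\frac{(q^{2\xi_j+2k_j};q^2)_{\eta_j}}{(q^{2k_j};q^2)_{\eta_j}}\,q^{-\eta_j\left(\eta_j+2\xi_j+h^-_{j-1,0}(\eta)+h^+_{j+1,0}(\xi)+k_j\right)},$$ is a duality function between $\mathrm{ASIP}(q,\vec k)$ and $\mathrm{ASIP}(q^{-1},\vec k)$: $[L^{\mathrm{ASIP}}_{q,\vec k}D(\cdot,\xi)](\eta)=[L^{\mathrm{ASIP}}_{q^{-1},\vec k}D(\eta,\cdot)](\xi)$ for all $\eta,\xi\in X_d$. (ii) The function $D^{\mathrm{tr}}:X_d\times X_d\to\mathbb R$, $$D^{\mathrm{tr}}(\eta,\xi)=\prod_{j=1}^M\frac{(q^{-2\xi_j};q^2)_{\eta_j}}{(q^{2k_j};q^2)_{\eta_j}}\,q^{-\eta_j\left(\eta_j-2\xi_j+h^-_{j-1,0}(\eta)-h^+_{j+1,0}(\xi)-k_j\right)}\,1_{\eta_j\le\xi_j},$$ is a self-duality function for $\mathrm{ASIP}(q,\vec k)$: $[L^{\mathrm{ASIP}}_{q,\vec k}D^{\mathrm{tr}}(\cdot,\xi)](\eta)=[L^{\mathrm{ASIP}}_{q,\vec k}D^{\mathrm{tr}}(\eta,\cdot)](\xi)$ for all $\eta,\xi\in X_d$.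
   Context: Notation: $X_d=\mathbb Z_{\ge0}^M$; $[a]_q=\frac{q^a-q^{-a}}{q-q^{-1}}$; $(a;q)_n=\prod_{i=0}^{n-1}(1-aq^i)$; $h^-_{j,0}(\eta)=\sum_{i=1}^j(2\eta_i+k_i)$, $h^+_{j,0}(\xi)=\sum_{i=j}^M(2\xi_i+k_i)$ (empty sums are $0$). $\eta^{j,m}$ is $\eta$ with one particle moved from $j$ to $m$ if $\eta_j\ge1$, else $\eta$. $\mathrm{ASIP}(q,\vec k)$ on $X_d$ (any $q>0$, $q\ne1$): $$[L^{\mathrm{ASIP}}_{q,\vec k}f](\eta)=\sum_{j=1}^{M-1}c_j^+[f(\eta^{j,j+1})-f(\eta)]+c_{j+1}^-[f(\eta^{j+1,j})-f(\eta)],$$ $c_j^+=q^{\eta_j+k_j-\eta_{j+1}-1}[\eta_j]_q[\eta_{j+1}+k_{j+1}]_q$, $c_j^-=q^{-(\eta_j+k_j-\eta_{j-1}-1)}[\eta_j]_q[\eta_{j-1}+k_{j-1}]_q$. *)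

theory Defs
  imports Complex_Main
begin

text \<open>
  Particle configurations on the sites \<open>1, \<dots>, M\<close>: an element of \<open>\<int>\<^sub>\<ge>\<^sub>0\<^sup>M\<close> is
  encoded as a function on all of \<open>nat\<close> that vanishes off \<open>{1..M}\<close>.
\<close>

definition configs :: "nat \<Rightarrow> (nat \<Rightarrow> nat) set" where
  "configs M = {\<eta>. \<forall>j. j \<notin> {1..M} \<longrightarrow> \<eta> j = 0}"

definition move :: "nat \<Rightarrow> nat \<Rightarrow> (nat \<Rightarrow> nat) \<Rightarrow> (nat \<Rightarrow> nat)" where
  "move j m \<eta> = (if \<eta> j \<ge> 1
     then (let \<eta>' = \<eta>(j := \<eta> j - 1) in \<eta>'(m := \<eta>' m + 1))
     else \<eta>)"

text \<open>
  Moves between sites stay inside \<open>configs M\<close>. Hence at \<open>\<eta> \<in> configs M\<close> the generator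
  below sees its argument \<open>f\<close> only through the restriction of \<open>f\<close> to \<open>configs M\<close>.
\<close>

lemma move_in_configs:
  assumes "\<eta> \<in> configs M" and "m \<in> {1..M}"
  shows "move j m \<eta> \<in> configs M"
  using assms by (auto simp: configs_def move_def Let_def)

definition q_number :: "real \<Rightarrow> real \<Rightarrow> real" where
  "q_number q a = (q powr a - q powr (- a)) / (q - inverse q)"

definition q_pochhammer :: "real \<Rightarrow> real \<Rightarrow> nat \<Rightarrow> real" where
  "q_pochhammer a q n = (\<Prod>i<n. 1 - a * q ^ i)"

definition h_minus :: "(nat \<Rightarrow> real) \<Rightarrow> nat \<Rightarrow> (nat \<Rightarrow> nat) \<Rightarrow> real" where
  "h_minus k j \<eta> = (\<Sum>i=1..j. 2 * real (\<eta> i) + k i)"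

definition h_plus :: "nat \<Rightarrow> (nat \<Rightarrow> real) \<Rightarrow> nat \<Rightarrow> (nat \<Rightarrow> nat) \<Rightarrow> real" where
  "h_plus M k j \<xi> = (\<Sum>i=j..M. 2 * real (\<xi> i) + k i)"

definition c_plus :: "real \<Rightarrow> (nat \<Rightarrow> real) \<Rightarrow> nat \<Rightarrow> (nat \<Rightarrow> nat) \<Rightarrow> real" where
  "c_plus q k j \<eta> =
     q powr (real (\<eta> j) + k j - real (\<eta> (j + 1)) - 1)
     * q_number q (real (\<eta> j)) * q_number q (real (\<eta> (j + 1)) + k (j + 1))"

text \<open>Only used for \<open>j \<ge> 2\<close>, so the index \<open>j - 1\<close> is not truncated.\<close>

definition c_minus :: "real \<Rightarrow> (nat \<Rightarrow> real) \<Rightarrow> nat \<Rightarrow> (nat \<Rightarrow> nat) \<Rightarrow> real" where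
  "c_minus q k j \<eta> =
     q powr (- (real (\<eta> j) + k j - real (\<eta> (j - 1)) - 1))
     * q_number q (real (\<eta> j)) * q_number q (real (\<eta> (j - 1)) + k (j - 1))"

definition ASIP_generator ::
  "nat \<Rightarrow> real \<Rightarrow> (nat \<Rightarrow> real) \<Rightarrow> ((nat \<Rightarrow> nat) \<Rightarrow> real) \<Rightarrow> (nat \<Rightarrow> nat) \<Rightarrow> real" where
  "ASIP_generator M q k f \<eta> =
     (\<Sum>j\<in>{1..<M}.
        c_plus q k j \<eta> * (f (move j (j + 1) \<eta>) - f \<eta>)
        + c_minus q k (j + 1) \<eta> * (f (move (j + 1) j \<eta>) - f \<eta>))"

definition duality_function ::
  "'a set \<Rightarrow> (('a \<Rightarrow> real) \<Rightarrow> 'a \<Rightarrow> real) \<Rightarrow> (('a \<Rightarrow> real) \<Rightarrow> 'a \<Rightarrow> real)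
    \<Rightarrow> ('a \<Rightarrow> 'a \<Rightarrow> real) \<Rightarrow> bool" where
  "duality_function X L1 L2 D \<longleftrightarrow>
     (\<forall>\<eta>\<in>X. \<forall>\<xi>\<in>X. L1 (\<lambda>\<eta>'. D \<eta>' \<xi>) \<eta> = L2 (\<lambda>\<xi>'. D \<eta> \<xi>') \<xi>)"

definition D_ASIP ::
  "nat \<Rightarrow> real \<Rightarrow> (nat \<Rightarrow> real) \<Rightarrow> (nat \<Rightarrow> nat) \<Rightarrow> (nat \<Rightarrow> nat) \<Rightarrow> real" where
  "D_ASIP M q k \<eta> \<xi> =
     (\<Prod>j=1..M.
        q_pochhammer (q powr (2 * real (\<xi> j) + 2 * k j)) (q\<^sup>2) (\<eta> j)
        / q_pochhammer (q powr (2 * k j)) (q\<^sup>2) (\<eta> j)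
        * q powr (- real (\<eta> j) *
            (real (\<eta> j) + 2 * real (\<xi> j) + h_minus k (j - 1) \<eta> + h_plus M k (j + 1) \<xi> + k j)))"

definition D_ASIP_tr ::
  "nat \<Rightarrow> real \<Rightarrow> (nat \<Rightarrow> real) \<Rightarrow> (nat \<Rightarrow> nat) \<Rightarrow> (nat \<Rightarrow> nat) \<Rightarrow> real" where
  "D_ASIP_tr M q k \<eta> \<xi> =
     (\<Prod>j=1..M.
        q_pochhammer (q powr (- 2 * real (\<xi> j))) (q\<^sup>2) (\<eta> j)
        / q_pochhammer (q powr (2 * k j)) (q\<^sup>2) (\<eta> j)
        * q powr (- real (\<eta> j) *
            (real (\<eta> j) - 2 * real (\<xi> j) + h_minus k (j - 1) \<eta> - h_plus M k (j + 1) \<xi> - k j))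
        * (if \<eta> j \<le> \<xi> j then 1 else 0))"

end

(*
  D and D^tr are two specialisations, x = xi and x = - xi - k, of one function of a
  configuration eta and a real vector x.  Up to factors that no jump across the bond
  (j, j + 1) changes, this function depends only on the four occupation numbers at that bond,
  since its exponent is -(N^2 + N |k| + 2 sum_j eta_j sum_{i >= j} x_i) with N = sum_j eta_j.
  Hence the duality holds bond by bond, where the contiguity relations of the q-Pochhammer
  symbols reduce it to a polynomial identity.  Replacing x by - x - k turns the jump rates of
  ASIP(1/q, k) into those of ASIP(q, k) with the directions exchanged.
*)
theory Submission
  imports Defs
begin

section \<open>Polynomial identity for a single bond\<close>

text \<open>
  Used with \<open>z = q\<^sup>2\<close>, with \<open>A, B, K, L\<close> the powers \<open>q powr (2 * t)\<close> for \<open>t = a, b, k, l\<close>, with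
  \<open>X, Y\<close> those for \<open>t = u + k, v + l\<close>, and with \<open>P, P'\<close> the weights at the two sites of the bond.
\<close>
lemma asip_pair_polynomial_identity:
  fixes z A B K L X Y P P' V V' :: real
  assumes nz: "z \<noteq> 0" "B \<noteq> 0" "X \<noteq> 0" "K \<noteq> 0" "L \<noteq> 0"
    and V: "V * (1 - X * A / z) = (1 - A) * P"
    and V': "V' * (1 - Y * B / z) = (1 - B) * P'"
  shows "K / (z * B) * (V * (1 - K * A / z) * P' * (1 - Y * B) * (X / K) - (A - 1) * (B * L - 1) * (P * P'))
     + 1 / B * (V' * (1 - L * B / z) * P * (1 - X * A) * (K / X) - (B - 1) * (A * K - 1) * (P * P'))
    = K / X * (X / K - 1) * (- ((P - X / z * V) * P' * (1 - Y * B)) / B - (Y - 1) * (P * P'))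
     + L * K / (z * X) * (Y / L - 1) * (- (P * (1 - X * A) * (P' - Y / z * V')) * B - (X - 1) * (P * P'))"
    (is "?l = ?r")
proof -
  \<comment> \<open>On the two sides, the terms in \<open>V\<close> and in \<open>V'\<close> combine
    to multiples of \<open>1 - X * A / z\<close> and \<open>1 - Y * B / z\<close>; this gives the
    two cofactors.\<close>
  have "?l - ?r = K / (z * B) * (1 - Y * B) * P' * (V * (1 - X * A / z) - (1 - A) * P)
      + K / X * (1 - X * A) * (1 / B + (Y - L) / z) * P * (V' * (1 - Y * B / z) - (1 - B) * P')"
    using nz by (simp add: divide_simps) algebra
  then show ?thesis
    using V V' by simp
qed

section \<open>Shift of q-Pochhammer symbols and resummation of the exponent\<close>

text \<open>The symbol of length \<open>n + 1\<close> can be split at its first or at its last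
  factor.\<close>

lemma q_pochhammer_shift:
  "(1 - x) * q_pochhammer (x * q) q n = (1 - x * q ^ n) * q_pochhammer x q n"
proof -
  have "(1 - x) * q_pochhammer (x * q) q n = q_pochhammer x q (Suc n)"
    unfolding q_pochhammer_def prod.lessThan_Suc_shift by (simp add: mult.assoc)
  then show ?thesis
    by (simp add: q_pochhammer_def)
qed

lemma sum_split_adjacent:
  fixes f :: "nat \<Rightarrow> real"
  assumes "i \<le> j" "Suc j \<le> M"
  shows "sum f {i..M} = f j + f (Suc j) + sum f ({i..M} - {j, Suc j})"
  using sum.subset_diff[of "{j, Suc j}" "{i..M}" f] assms by auto

text \<open>The squares and the cross terms \<open>2 * n i * n j\<close> with \<open>i < j\<close>
  make up the square of the total, and the \<open>k\<close> below, at and above \<open>j\<close>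
  make up the whole sum of \<open>k\<close>.\<close>

lemma duality_exponent_eq:
  fixes n x k :: "nat \<Rightarrow> real"
  shows "(\<Sum>j=1..M. n j * (n j + 2 * x j + (\<Sum>i=1..j-1. 2 * n i + k i) + (\<Sum>i=j+1..M. 2 * x i + k i) + k j))
    = (\<Sum>j=1..M. n j)\<^sup>2 + (\<Sum>j=1..M. n j) * (\<Sum>j=1..M. k j) + 2 * (\<Sum>j=1..M. n j * (\<Sum>i=j..M. x i))"
proof (induction M)
  case (Suc M)
  have 1: "(\<Sum>j=1..M. n j * (n j + 2 * x j + (\<Sum>i=1..j-1. 2 * n i + k i) + (\<Sum>i=j+1..Suc M. 2 * x i + k i) + k j))
    = (\<Sum>j=1..M. n j * (n j + 2 * x j + (\<Sum>i=1..j-1. 2 * n i + k i) + (\<Sum>i=j+1..M. 2 * x i + k i) + k j))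
      + (\<Sum>j=1..M. n j) * (2 * x (Suc M) + k (Suc M))"
    unfolding sum_distrib_right sum.distrib[symmetric]
    by (intro sum.cong) (auto simp: algebra_simps)
  have 2: "(\<Sum>j=1..M. n j * (\<Sum>i=j..Suc M. x i))
    = (\<Sum>j=1..M. n j * (\<Sum>i=j..M. x i)) + (\<Sum>j=1..M. n j) * x (Suc M)"
    unfolding sum_distrib_right sum.distrib[symmetric]
    by (intro sum.cong) (auto simp: algebra_simps)
  have 3: "(\<Sum>i=1..M. 2 * n i + k i) = 2 * (\<Sum>i=1..M. n i) + (\<Sum>i=1..M. k i)"
    by (simp add: sum.distrib sum_distrib_left)
  have "(\<Sum>j=1..Suc M. n j * (n j + 2 * x j + (\<Sum>i=1..j-1. 2 * n i + k i) + (\<Sum>i=j+1..Suc M. 2 * x i + k i) + k j))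
    = (\<Sum>j=1..M. n j * (n j + 2 * x j + (\<Sum>i=1..j-1. 2 * n i + k i) + (\<Sum>i=j+1..Suc M. 2 * x i + k i) + k j))
     + n (Suc M) * (n (Suc M) + 2 * x (Suc M) + (\<Sum>i=1..M. 2 * n i + k i) + k (Suc M))"
    by simp
  then show ?case
    unfolding 1 3 Suc.IH 2
    using 2 by (simp add: algebra_simps power2_eq_square)
qed simp

section \<open>Weight of one site and its contiguity relations\<close>

text \<open>\<open>u\<close> is real, so that both \<open>u = \<xi> j\<close> and
  \<open>u = - \<xi> j - k j\<close> can be inserted.\<close>

definition site_weight :: "real \<Rightarrow> real \<Rightarrow> nat \<Rightarrow> real \<Rightarrow> real" where
  "site_weight q k a u =
     q_pochhammer (q powr (2 * u + 2 * k)) (q\<^sup>2) a / q_pochhammer (q powr (2 * k)) (q\<^sup>2) a"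

lemma powr_double_nat: "0 < q \<Longrightarrow> q powr (2 * real a) = (q\<^sup>2) ^ a"
  by (simp add: powr_realpow[symmetric] powr_powr mult.commute flip: powr_numeral)

lemma denominator_factor_nonzero:
  fixes q k :: real
  assumes "0 < q" "q < 1" "0 < k"
  shows "1 - q powr (2 * k) * (q\<^sup>2) ^ a \<noteq> 0"
proof -
  have "q powr (2 * k) * (q\<^sup>2) ^ a = q powr (2 * k + 2 * real a)"
    using assms by (simp add: powr_add powr_double_nat)
  also have "\<dots> < 1"
    using assms powr_less_mono'[of q 0 "2 * k + 2 * real a"] by simp
  finally show ?thesis by simp
qed

lemma denominator_nonzero:
  assumes "0 < q" "q < 1" "0 < k"
  shows "q_pochhammer (q powr (2 * k)) (q\<^sup>2) a \<noteq> 0"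
  using denominator_factor_nonzero[OF assms] by (simp add: q_pochhammer_def)

lemma site_weight_Suc:
  assumes "0 < q" "q < 1" "0 < k"
  shows "site_weight q k (Suc a) u * (1 - q powr (2 * k) * q powr (2 * real a))
    = site_weight q k a u * (1 - q powr (2 * u + 2 * k) * q powr (2 * real a))"
  unfolding site_weight_def powr_double_nat[OF assms(1)]
  using denominator_nonzero[OF assms] denominator_factor_nonzero[OF assms]
  by (simp add: q_pochhammer_def divide_simps)

text \<open>Raising \<open>u\<close> by one shifts the base of the numerator. The factor in front is
  not divided out, as it vanishes at \<open>u = - k\<close>.\<close>

lemma site_weight_plus_one:
  assumes "0 < q"
  shows "(1 - q powr (2 * u + 2 * k)) * site_weight q k a (u + 1)
    = site_weight q k a u * (1 - q powr (2 * u + 2 * k) * q powr (2 * real a))"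
proof -
  have e: "q powr (2 * (u + 1) + 2 * k) = q powr (2 * u + 2 * k) * q\<^sup>2"
    using assms powr_add[of q "2 * u + 2 * k" 2] by (simp add: algebra_simps)
  show ?thesis
    unfolding site_weight_def e powr_double_nat[OF assms(1)] times_divide_eq_right
      q_pochhammer_shift by (simp add: mult.commute)
qed

text \<open>
  For \<open>a \<ge> 1\<close> the number \<open>V\<close> is a multiple of the weight at \<open>a - 1\<close>. The factor
  \<open>1 - q powr (2 * a)\<close>, which comes from the jump rate, makes the relations hold for \<open>a = 0\<close>
  as well, where \<open>a - 1\<close> is truncated.
\<close>
lemma site_weight_minus_one:
  assumes "0 < q" "q < 1" "0 < k"
  obtains V where
    "V * (1 - q powr (2 * u + 2 * k) * q powr (2 * real a) / q\<^sup>2)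
       = (1 - q powr (2 * real a)) * site_weight q k a u"
    "V * (1 - q powr (2 * k) * q powr (2 * real a) / q\<^sup>2)
       = (1 - q powr (2 * real a)) * site_weight q k (a - 1) u"
    "site_weight q k a (u - 1) = site_weight q k a u - q powr (2 * u + 2 * k) / q\<^sup>2 * V"
proof (cases a)
  case 0
  show ?thesis
    \<comment> \<open>Both weights are empty products and \<open>1 - q powr 0 = 0\<close>, so
      \<open>V = 0\<close> solves all three relations.\<close>
    using assms by (intro that[of 0]) (simp_all add: 0 site_weight_def q_pochhammer_def)
next
  case (Suc m)
  define X where "X = q powr (2 * u + 2 * k)"
  define K where "K = q powr (2 * k)"
  define z where "z = q\<^sup>2"
  have z: "z \<noteq> 0" using assms by (simp add: z_def)
  have A: "q powr (2 * real a) = z * z ^ m"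
    unfolding powr_double_nat[OF assms(1)] Suc z_def by simp
  have e: "q powr (2 * (u - 1) + 2 * k) = X / z"
    using assms powr_diff[of q "2 * u + 2 * k" 2] by (simp add: X_def z_def algebra_simps)
  have dm: "q_pochhammer K z m \<noteq> 0" and dS: "1 - K * z ^ m \<noteq> 0"
    using denominator_nonzero[OF assms] denominator_factor_nonzero[OF assms]
    by (simp_all add: K_def z_def)
  have S: "q_pochhammer x z (Suc m) = q_pochhammer x z m * (1 - x * z ^ m)" for x
    by (simp add: q_pochhammer_def)
  \<comment> \<open>The numerator at \<open>u - 1\<close> starts one factor lower; without that
    factor it is the numerator for \<open>a - 1\<close> at \<open>u\<close>.\<close>
  have S': "q_pochhammer (X / z) z (Suc m) = (1 - X / z) * q_pochhammer X z m"
    unfolding q_pochhammer_def prod.lessThan_Suc_shift using z by simp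
  define p where "p = q_pochhammer X z m"
  define r where "r = q_pochhammer K z m"
  \<comment> \<open>Solved from the second relation, where \<open>1 - K * z ^ m\<close> is nonzero;
    \<open>1 - X * z ^ m\<close> in the first one may vanish.\<close>
  define V where "V = (1 - z * z ^ m) * p / (r * (1 - K * z ^ m))"
  have w: "site_weight q k a u = p * (1 - X * z ^ m) / (r * (1 - K * z ^ m))"
      "site_weight q k (a - 1) u = p / r"
      "site_weight q k a (u - 1) = (1 - X / z) * p / (r * (1 - K * z ^ m))"
    unfolding site_weight_def e Suc diff_Suc_1 X_def[symmetric] K_def[symmetric] z_def[symmetric]
    unfolding S' by (simp_all only: S p_def r_def)
  have nz: "r \<noteq> 0" "1 - K * z ^ m \<noteq> 0"
    using dm dS by (simp_all add: r_def)
  show ?thesis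
  proof (rule that[of V]; unfold w A; fold X_def K_def z_def)
    show "V * (1 - X * (z * z ^ m) / z) = (1 - z * z ^ m) * (p * (1 - X * z ^ m) / (r * (1 - K * z ^ m)))"
      using z by (simp add: V_def)
    show "V * (1 - K * (z * z ^ m) / z) = (1 - z * z ^ m) * (p / r)"
      using z nz by (simp add: V_def)
    have "(1 - X / z) * p = p * (1 - X * z ^ m) - X / z * ((1 - z * z ^ m) * p)"
      using z by (simp add: field_simps)
    then show "(1 - X / z) * p / (r * (1 - K * z ^ m))
        = p * (1 - X * z ^ m) / (r * (1 - K * z ^ m)) - X / z * V"
      unfolding V_def by (simp only: diff_divide_distrib times_divide_eq_right[symmetric])
  qed
qed

section \<open>Symmetries of q-numbers\<close>

lemma q_number_alt:
  assumes "0 < q"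
  shows "q_number q t = (q powr (2 * t) - 1) / (q powr t * (q - inverse q))"
  unfolding q_number_def powr_minus mult_2 powr_add
  \<comment> \<open>For \<open>q = 1\<close> both sides are divisions by zero, hence 0.\<close>
  using assms by (cases "q - inverse q = 0") (simp_all add: field_simps)

lemma inverse_base_powr: "0 < q \<Longrightarrow> inverse q powr t = q powr (- t)" for q :: real
  by (simp add: powr_minus inverse_powr)

lemma q_number_inverse:
  assumes "0 < q"
  shows "q_number (inverse q) t = q_number q t"
proof -
  have "q_number (inverse q) t = (- (q powr t - q powr (- t))) / (- (q - inverse q))"
    using assms by (simp add: q_number_def inverse_base_powr)
  then show ?thesis
    unfolding q_number_def minus_divide_divide .
qed

lemma q_number_minus: "q_number q (- t) = - q_number q t"
  by (simp add: q_number_def diff_divide_distrib)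

lemma q_number_0 [simp]: "q_number q 0 = 0"
  by (simp add: q_number_def)

section \<open>Duality across one bond\<close>

text \<open>The exponent is the share \<open>a * (u + v) + b * v\<close> of the bond in the sum of
  \<open>\<eta> j * (\<Sum>i=j..M. x i)\<close>, without the tail of \<open>x\<close> beyond the
  bond.\<close>

definition pair_weight :: "real \<Rightarrow> real \<Rightarrow> real \<Rightarrow> nat \<Rightarrow> nat \<Rightarrow> real \<Rightarrow> real \<Rightarrow> real" where
  "pair_weight q k l a b u v = site_weight q k a u * site_weight q l b v
     * q powr (- 2 * ((real a + real b) * v + real a * u))"

text \<open>The rates supply the factors with which the contiguity relations express the weights
  after a jump by \<open>P\<close>, \<open>P'\<close>, \<open>V\<close>, \<open>V'\<close>. Only
  \<open>a - 1\<close> and \<open>b - 1\<close> are truncated, and their rates vanish at 0.\<close>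

lemma pair_duality:
  assumes q: "0 < q" "q < 1" and "0 < k" "0 < l"
  shows "q powr (a + k - b - 1) * q_number q a * q_number q (b + l)
        * (pair_weight q k l (a - 1) (b + 1) u v - pair_weight q k l a b u v)
      + q powr (- (b + l - a - 1)) * q_number q b * q_number q (a + k)
        * (pair_weight q k l (a + 1) (b - 1) u v - pair_weight q k l a b u v)
    = q powr (- (u + k - v - 1)) * q_number q u * q_number q (v + l)
        * (pair_weight q k l a b (u - 1) (v + 1) - pair_weight q k l a b u v)
      + q powr (v + l - u - 1) * q_number q v * q_number q (u + k)
        * (pair_weight q k l a b (u + 1) (v - 1) - pair_weight q k l a b u v)"
proof -
  define d where "d = q - inverse q"
  have d: "d \<noteq> 0"
    using q one_less_inverse[of q] by (simp add: d_def)
  define z where "z = q\<^sup>2"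
  define A where "A = q powr (2 * real a)"
  define B where "B = q powr (2 * real b)"
  define K where "K = q powr (2 * k)"
  define L where "L = q powr (2 * l)"
  define X where "X = q powr (2 * u + 2 * k)"
  define Y where "Y = q powr (2 * v + 2 * l)"
  define P where "P = site_weight q k a u"
  define P' where "P' = site_weight q l b v"
  define E where "E = q powr (- 2 * ((real a + real b) * v + real a * u))"
  \<comment> \<open>The factor shared by all four rates; what remains is rational in
    \<open>z\<close>, \<open>A\<close>, \<open>B\<close>, \<open>K\<close>, \<open>L\<close>,
    \<open>X\<close>, \<open>Y\<close>.\<close>
  define c where "c = q powr (1 - k - l) / d\<^sup>2"
  have pos: "z > 0" "A > 0" "B > 0" "K > 0" "L > 0" "X > 0" "Y > 0"
    using q by (simp_all add: z_def A_def B_def K_def L_def X_def Y_def)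
  note pw = powr_add powr_diff powr_minus mult_2 powr_one[OF order_less_imp_le[OF q(1)]]
  have r1: "q powr (a + k - b - 1) * q_number q a * q_number q (b + l)
      = c * (K / (z * B) * (A - 1) * (B * L - 1))"
    unfolding q_number_alt[OF q(1)] d_def[symmetric] c_def K_def z_def A_def B_def L_def pw
    using q d by (simp add: field_simps power2_eq_square)
  have r2: "q powr (- (b + l - a - 1)) * q_number q b * q_number q (a + k)
      = c * (1 / B * (B - 1) * (A * K - 1))"
    unfolding q_number_alt[OF q(1)] d_def[symmetric] c_def K_def z_def A_def B_def L_def pw
    using q d by (simp add: field_simps power2_eq_square)
  have r3: "q powr (- (u + k - v - 1)) * q_number q u * q_number q (v + l)
      = c * (K / X * (X / K - 1) * (Y - 1))"
    unfolding q_number_alt[OF q(1)] d_def[symmetric] c_def K_def X_def Y_def pw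
    using q d by (simp add: field_simps power2_eq_square)
  have r4: "q powr (v + l - u - 1) * q_number q v * q_number q (u + k)
      = c * (L * K / (z * X) * (Y / L - 1) * (X - 1))"
    unfolding q_number_alt[OF q(1)] d_def[symmetric] c_def K_def X_def Y_def L_def z_def pw
    using q d by (simp add: field_simps power2_eq_square)
  obtain V where V: "V * (1 - X * A / z) = (1 - A) * P"
      "V * (1 - K * A / z) = (1 - A) * site_weight q k (a - 1) u"
      "site_weight q k a (u - 1) = P - X / z * V"
    using site_weight_minus_one[OF q \<open>0 < k\<close>]
    unfolding X_def A_def z_def P_def K_def by metis
  obtain V' where V': "V' * (1 - Y * B / z) = (1 - B) * P'"
      "V' * (1 - L * B / z) = (1 - B) * site_weight q l (b - 1) v"
      "site_weight q l b (v - 1) = P' - Y / z * V'"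
    using site_weight_minus_one[OF q \<open>0 < l\<close>]
    unfolding Y_def B_def z_def P'_def L_def by metis
  have Sa: "site_weight q k (a + 1) u * (1 - K * A) = P * (1 - X * A)"
    and Sb: "site_weight q l (b + 1) v * (1 - L * B) = P' * (1 - Y * B)"
    unfolding K_def L_def A_def B_def X_def Y_def P_def P'_def
    using site_weight_Suc[OF q \<open>0 < k\<close>] site_weight_Suc[OF q \<open>0 < l\<close>] by simp_all
  have Ua: "(1 - X) * site_weight q k a (u + 1) = P * (1 - X * A)"
    and Ub: "(1 - Y) * site_weight q l b (v + 1) = P' * (1 - Y * B)"
    unfolding A_def B_def X_def Y_def P_def P'_def
    using site_weight_plus_one[OF q(1)] by simp_all
  have W: "pair_weight q k l a b u v = P * P' * E"
    by (simp add: pair_weight_def P_def P'_def E_def)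
  have w1: "(A - 1) * (B * L - 1) * pair_weight q k l (a - 1) (b + 1) u v
      = V * (1 - K * A / z) * P' * (1 - Y * B) * (X / K) * E"
  \<comment> \<open>At \<open>a = 0\<close>, \<open>A = 1\<close> and the second relation for
    \<open>V\<close> make both sides 0.\<close>
  proof (cases "a = 0")
    case True
    then show ?thesis using V(2) q by (simp add: A_def)
  next
    case False
    \<comment> \<open>A particle moving right lowers \<open>(a + b) * v + a * u\<close> by
      \<open>u\<close>, and \<open>X / K = q powr (2 * u)\<close>.\<close>
    have e: "q powr (- 2 * ((real (a - 1) + real (b + 1)) * v + real (a - 1) * u)) = X / K * E"
      using q False
      by (simp add: E_def X_def K_def powr_add[symmetric] powr_diff[symmetric] algebra_simps)
    have h: "(A - 1) * (B * L - 1) * (s * t * f) = ((1 - A) * s) * (t * (1 - L * B)) * f" for s t f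
      by algebra
    then show ?thesis unfolding pair_weight_def e h Sb V(2)[symmetric] by (simp only: mult.assoc)
  qed
  have w2: "(B - 1) * (A * K - 1) * pair_weight q k l (a + 1) (b - 1) u v
      = V' * (1 - L * B / z) * P * (1 - X * A) * (K / X) * E"
  proof (cases "b = 0")
    case True
    then show ?thesis using V'(2) q by (simp add: B_def)
  next
    case False
    have e: "q powr (- 2 * ((real (a + 1) + real (b - 1)) * v + real (a + 1) * u)) = K / X * E"
      using q False
      by (simp add: E_def X_def K_def powr_add[symmetric] powr_diff[symmetric] algebra_simps)
    have h: "(B - 1) * (A * K - 1) * (s * t * f) = ((1 - B) * t) * (s * (1 - K * A)) * f" for s t f
      by algebra
    then show ?thesis unfolding pair_weight_def e h Sa V'(2)[symmetric] by (simp only: ac_simps)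
  qed
  have w3: "(Y - 1) * pair_weight q k l a b (u - 1) (v + 1)
      = - ((P - X / z * V) * P' * (1 - Y * B)) / B * E"
  proof -
    \<comment> \<open>A unit moving from \<open>u\<close> to \<open>v\<close> raises
      \<open>(a + b) * v + a * u\<close> by \<open>b\<close>, and
      \<open>B = q powr (2 * b)\<close>.\<close>
    have e: "q powr (- 2 * ((real a + real b) * (v + 1) + real a * (u - 1))) = E / B"
      unfolding E_def B_def powr_diff[symmetric] by (rule arg_cong[where f = "(powr) q"]) (simp add: algebra_simps)
    have h: "(Y - 1) * (s * t * f) = - (s * ((1 - Y) * t) * f)" for s t f
      by algebra
    then show ?thesis unfolding pair_weight_def e h Ub V(3) by simp
  qed
  have w4: "(X - 1) * pair_weight q k l a b (u + 1) (v - 1)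
      = - (P * (1 - X * A) * (P' - Y / z * V')) * B * E"
  proof -
    have e: "q powr (- 2 * ((real a + real b) * (v - 1) + real a * (u + 1))) = E * B"
      using q by (simp add: E_def B_def powr_add[symmetric] algebra_simps)
    have h: "(X - 1) * (s * t * f) = - (((1 - X) * s) * t * f)" for s t f
      by algebra
    then show ?thesis unfolding pair_weight_def e h Ua V'(3) by simp
  qed
  \<comment> \<open>The rate factor \<open>p\<close> turns the weight \<open>g\<close> after the
    jump into \<open>s * E\<close>; so \<open>c * E\<close> comes out of all four terms and the
    polynomial identity remains.\<close>
  have scale: "c * \<kappa> * (g - w * E) = c * E * (\<mu> * (s - p * w))"
    if "\<kappa> = \<mu> * p" "p * g = s * E" for \<kappa> \<mu> g s p w
  proof -
    have "c * \<kappa> * (g - w * E) = c * \<mu> * (p * g) - c * \<mu> * p * (w * E)"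
      unfolding that(1) by algebra
    then show ?thesis
      unfolding that(2) by algebra
  qed
  show ?thesis
    unfolding r1 r2 r3 r4 W
      scale[OF mult.assoc w1] scale[OF mult.assoc w2] scale[OF refl w3] scale[OF refl w4]
      distrib_left[symmetric]
    using asip_pair_polynomial_identity[of z B X K L V A P V' Y P'] V(1) V'(1) pos by simp
qed

section \<open>The common duality function and its two specialisations\<close>

text \<open>The exponent is in collected form, which shows what a jump leaves unchanged.\<close>

definition D_real ::
  "nat \<Rightarrow> real \<Rightarrow> (nat \<Rightarrow> real) \<Rightarrow> (nat \<Rightarrow> nat) \<Rightarrow> (nat \<Rightarrow> real) \<Rightarrow> real" where
  "D_real M q k \<eta> x =
     (\<Prod>j=1..M. site_weight q (k j) (\<eta> j) (x j))
     * q powr (- ((\<Sum>j=1..M. real (\<eta> j))\<^sup>2 + (\<Sum>j=1..M. real (\<eta> j)) * (\<Sum>j=1..M. k j)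
         + 2 * (\<Sum>j=1..M. real (\<eta> j) * (\<Sum>i=j..M. x i))))"

lemma D_real_alt:
  assumes "0 < q"
  shows "D_real M q k \<eta> x = (\<Prod>j=1..M. site_weight q (k j) (\<eta> j) (x j)
    * q powr (- real (\<eta> j) * (real (\<eta> j) + 2 * x j + h_minus k (j - 1) \<eta>
        + (\<Sum>i=j+1..M. 2 * x i + k i) + k j)))"
  unfolding D_real_def duality_exponent_eq[symmetric] prod.distrib h_minus_def
  using assms by (simp add: powr_sum sum_negf[symmetric])

lemma D_ASIP_eq_D_real:
  assumes "0 < q"
  shows "D_ASIP M q k \<eta> \<xi> = D_real M q k \<eta> (\<lambda>i. real (\<xi> i))"
  unfolding D_ASIP_def D_real_alt[OF assms] site_weight_def h_plus_def ..

text \<open>The factor with index \<open>x\<close> is \<open>1 - 1\<close>.\<close>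

lemma q_pochhammer_eq_0:
  assumes "0 < q" "x < n"
  shows "q_pochhammer (q powr (- 2 * real x)) (q\<^sup>2) n = 0"
proof -
  have "q powr (- 2 * real x) * (q\<^sup>2) ^ x = 1"
    using assms powr_double_nat[of q x] by (simp add: powr_minus)
  then show ?thesis
    using assms(2) by (auto simp: q_pochhammer_def intro!: bexI[of _ x])
qed

text \<open>The indicator in \<open>D_ASIP_tr\<close> is redundant: the numerator vanishes for \<open>\<eta> j > \<xi> j\<close>.\<close>
lemma D_ASIP_tr_eq_D_real:
  assumes "0 < q"
  shows "D_ASIP_tr M q k \<eta> \<xi> = D_real M q k \<eta> (\<lambda>i. - real (\<xi> i) - k i)"
  unfolding D_ASIP_tr_def D_real_alt[OF assms]
proof (rule prod.cong)
  fix j assume "j \<in> {1..M}"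
  \<comment> \<open>Each summand changes sign:
    \<open>2 * (- \<xi> - k) + k = - (2 * \<xi> + k)\<close>.\<close>
  have h: "(\<Sum>i=j+1..M. 2 * (- real (\<xi> i) - k i) + k i) = - h_plus M k (j + 1) \<xi>"
    unfolding h_plus_def sum_negf[symmetric] by (rule sum.cong) simp_all
  have s: "site_weight q (k j) (\<eta> j) (- real (\<xi> j) - k j)
      = q_pochhammer (q powr (- 2 * real (\<xi> j))) (q\<^sup>2) (\<eta> j)
        / q_pochhammer (q powr (2 * k j)) (q\<^sup>2) (\<eta> j)"
    by (simp add: site_weight_def)
  have e: "real (\<eta> j) + 2 * (- real (\<xi> j) - k j) + h_minus k (j - 1) \<eta> + - h_plus M k (j + 1) \<xi> + k j
     = real (\<eta> j) - 2 * real (\<xi> j) + h_minus k (j - 1) \<eta> - h_plus M k (j + 1) \<xi> - k j"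
    by simp
  show "q_pochhammer (q powr (- 2 * real (\<xi> j))) (q\<^sup>2) (\<eta> j)
        / q_pochhammer (q powr (2 * k j)) (q\<^sup>2) (\<eta> j)
        * q powr (- real (\<eta> j) *
            (real (\<eta> j) - 2 * real (\<xi> j) + h_minus k (j - 1) \<eta> - h_plus M k (j + 1) \<xi> - k j))
        * (if \<eta> j \<le> \<xi> j then 1 else 0)
    = site_weight q (k j) (\<eta> j) (- real (\<xi> j) - k j)
      * q powr (- real (\<eta> j) * (real (\<eta> j) + 2 * (- real (\<xi> j) - k j) + h_minus k (j - 1) \<eta>
        + (\<Sum>i=j+1..M. 2 * (- real (\<xi> i) - k i) + k i) + k j))"
    unfolding h s e using q_pochhammer_eq_0[OF assms, of "\<xi> j" "\<eta> j"] by auto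
qed simp

section \<open>Localisation at a bond\<close>

text \<open>The sums \<open>a + b\<close> and \<open>u + v\<close> fix the particle total and all
  tails of \<open>x\<close> that start outside the bond, so one \<open>R\<close> serves all
  \<open>a\<close>, \<open>b\<close>, \<open>u\<close>, \<open>v\<close>.\<close>

lemma D_real_pair_factor:
  assumes j: "j \<in> {1..<M}"
  obtains R where "\<And>a b u v. a + b = \<eta> j + \<eta> (Suc j) \<Longrightarrow> u + v = x j + x (Suc j) \<Longrightarrow>
    D_real M q k (\<eta>(j := a, Suc j := b)) (x(j := u, Suc j := v))
      = R * pair_weight q (k j) (k (Suc j)) a b u v"
proof -
  define I where "I = {1..M} - {j, Suc j}"
  define N where "N = (\<Sum>i=1..M. real (\<eta> i))"
  define T where "T = (\<Sum>i=Suc (Suc j)..M. x i)"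
  define C where "C = (\<Sum>i\<in>I. real (\<eta> i) * (\<Sum>l=i..M. x l))"
  \<comment> \<open>The exponent without the bond's share; every particle on the bond contributes
    the same tail \<open>T\<close>.\<close>
  define G where "G = - (N\<^sup>2 + N * (\<Sum>i=1..M. k i) + 2 * ((real (\<eta> j) + real (\<eta> (Suc j))) * T + C))"
  define Q where "Q = (\<Prod>i\<in>I. site_weight q (k i) (\<eta> i) (x i))"
  have js: "1 \<le> j" "Suc j \<le> M"
    using j by auto
  show ?thesis
  proof (rule that[of "Q * q powr G"])
    fix a b u v
    assume ab: "a + b = \<eta> j + \<eta> (Suc j)" and uv: "u + v = x j + x (Suc j)"
    define n where "n = \<eta>(j := a, Suc j := b)"
    define y where "y = x(j := u, Suc j := v)"
    have ab': "real a + real b = real (\<eta> j) + real (\<eta> (Suc j))"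
      using ab by (metis of_nat_add)
    have upd: "n j = a" "n (Suc j) = b" "y j = u" "y (Suc j) = v"
      "\<And>i. i \<in> I \<Longrightarrow> n i = \<eta> i" "\<And>i. i \<in> I \<Longrightarrow> y i = x i"
      by (auto simp: n_def y_def I_def)
    have "(\<Prod>i=1..M. site_weight q (k i) (n i) (y i))
        = (\<Prod>i\<in>{j, Suc j}. site_weight q (k i) (n i) (y i)) * (\<Prod>i\<in>I. site_weight q (k i) (n i) (y i))"
      using prod.subset_diff[of "{j, Suc j}" "{1..M}" "\<lambda>i. site_weight q (k i) (n i) (y i)"] j
      by (auto simp: I_def mult.commute)
    then have P: "(\<Prod>i=1..M. site_weight q (k i) (n i) (y i))
        = site_weight q (k j) a u * site_weight q (k (Suc j)) b v * Q"
      by (simp add: upd Q_def)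
    have N: "(\<Sum>i=1..M. real (n i)) = N"
      unfolding N_def sum_split_adjacent[OF js] I_def[symmetric] using ab' by (simp add: upd)
    have T2: "(\<Sum>i=Suc j..M. y i) = v + T" and T1: "(\<Sum>i=j..M. y i) = u + v + T"
      using j by (simp_all add: T_def sum.atLeast_Suc_atMost upd, simp_all add: y_def)
    \<comment> \<open>A tail from the left of the bond contains both of its sites, one from the
      right neither.\<close>
    have tail: "(\<Sum>l=i..M. y l) = (\<Sum>l=i..M. x l)" if "i \<in> I" for i
    proof (cases "i < j")
      case True
      have "(\<Sum>l\<in>{i..M} - {j, Suc j}. y l) = (\<Sum>l\<in>{i..M} - {j, Suc j}. x l)"
        by (intro sum.cong) (auto simp: y_def)
      then show ?thesis using True j uv by (simp add: sum_split_adjacent[of i j M] upd)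
    next
      case False
      then show ?thesis using that by (intro sum.cong) (auto simp: I_def y_def)
    qed
    have S: "(\<Sum>i=1..M. real (n i) * (\<Sum>l=i..M. y l))
        = real a * (u + v + T) + real b * (v + T) + C"
      unfolding C_def sum_split_adjacent[OF js] I_def[symmetric] T1 T2 by (simp add: upd tail)
    have X: "- (N\<^sup>2 + N * (\<Sum>i=1..M. k i) + 2 * (real a * (u + v + T) + real b * (v + T) + C))
      = G + - 2 * ((real a + real b) * v + real a * u)"
      unfolding G_def ab'[symmetric] by (simp add: algebra_simps)
    show "D_real M q k (\<eta>(j := a, Suc j := b)) (x(j := u, Suc j := v))
      = Q * q powr G * pair_weight q (k j) (k (Suc j)) a b u v"
      unfolding n_def[symmetric] y_def[symmetric] D_real_def P N S X powr_add pair_weight_def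
      by (simp only: ac_simps)
  qed
qed

text \<open>Both moves become updates in the order \<open>j\<close>, \<open>Suc j\<close>, the shape
  that \<open>D_real_pair_factor\<close> expects.\<close>

lemma move_alt:
  "1 \<le> \<eta> j \<Longrightarrow> move j (Suc j) \<eta> = \<eta>(j := \<eta> j - 1, Suc j := \<eta> (Suc j) + 1)"
  "1 \<le> \<eta> (Suc j) \<Longrightarrow> move (Suc j) j \<eta> = \<eta>(j := \<eta> j + 1, Suc j := \<eta> (Suc j) - 1)"
  by (auto simp: move_def Let_def fun_eq_iff)

text \<open>This is \<open>pair_duality\<close> times \<open>R\<close>. On the right stand the rates
  of ASIP(1/q, k) continued to real \<open>x\<close>, hence not in terms of \<open>c_plus\<close>
  and \<open>c_minus\<close>.\<close>

lemma D_real_bond: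
  assumes q: "0 < q" "q < 1" and k: "\<forall>j\<in>{1..M}. k j > 0" and j: "j \<in> {1..<M}"
  shows "c_plus q k j \<eta> * (D_real M q k (move j (Suc j) \<eta>) x - D_real M q k \<eta> x)
      + c_minus q k (Suc j) \<eta> * (D_real M q k (move (Suc j) j \<eta>) x - D_real M q k \<eta> x)
    = q powr (- (x j + k j - x (Suc j) - 1)) * q_number q (x j) * q_number q (x (Suc j) + k (Suc j))
        * (D_real M q k \<eta> (x(j := x j - 1, Suc j := x (Suc j) + 1)) - D_real M q k \<eta> x)
      + q powr (x (Suc j) + k (Suc j) - x j - 1) * q_number q (x (Suc j)) * q_number q (x j + k j)
        * (D_real M q k \<eta> (x(j := x j + 1, Suc j := x (Suc j) - 1)) - D_real M q k \<eta> x)"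
    (is "?l1 + ?l2 = ?r1 + ?r2")
proof -
  obtain R where R: "\<And>a b u v. a + b = \<eta> j + \<eta> (Suc j) \<Longrightarrow> u + v = x j + x (Suc j) \<Longrightarrow>
    D_real M q k (\<eta>(j := a, Suc j := b)) (x(j := u, Suc j := v))
      = R * pair_weight q (k j) (k (Suc j)) a b u v"
    using D_real_pair_factor[OF j] by blast
  let ?w = "pair_weight q (k j) (k (Suc j))"
  let ?a = "\<eta> j" and ?b = "\<eta> (Suc j)" and ?u = "x j" and ?v = "x (Suc j)"
  have D: "D_real M q k \<eta> x = R * ?w ?a ?b ?u ?v"
    using R[of ?a ?b ?u ?v] by simp
  have l1: "?l1 = R * (q powr (?a + k j - ?b - 1) * q_number q ?a * q_number q (?b + k (Suc j))
        * (?w (?a - 1) (?b + 1) ?u ?v - ?w ?a ?b ?u ?v))"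
  \<comment> \<open>At \<open>?a = 0\<close> the truncated \<open>?a - 1\<close> would break the
    conserved total, but the rate is 0.\<close>
  proof (cases "?a = 0")
    case True
    then show ?thesis by (simp add: c_plus_def)
  next
    case False
    then show ?thesis
      using R[of "?a - 1" "?b + 1" ?u ?v]
      by (simp add: c_plus_def move_alt D right_diff_distrib)
  qed
  have l2: "?l2 = R * (q powr (- (?b + k (Suc j) - ?a - 1)) * q_number q ?b * q_number q (?a + k j)
        * (?w (?a + 1) (?b - 1) ?u ?v - ?w ?a ?b ?u ?v))"
  proof (cases "?b = 0")
    case True
    then show ?thesis by (simp add: c_minus_def)
  next
    case False
    then show ?thesis
      using R[of "?a + 1" "?b - 1" ?u ?v]
      by (simp add: c_minus_def move_alt D right_diff_distrib)
  qed
  have r1: "?r1 = R * (q powr (- (?u + k j - ?v - 1)) * q_number q ?u * q_number q (?v + k (Suc j))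
        * (?w ?a ?b (?u - 1) (?v + 1) - ?w ?a ?b ?u ?v))"
    using R[of ?a ?b "?u - 1" "?v + 1"] by (simp add: D right_diff_distrib)
  have r2: "?r2 = R * (q powr (?v + k (Suc j) - ?u - 1) * q_number q ?v * q_number q (?u + k j)
        * (?w ?a ?b (?u + 1) (?v - 1) - ?w ?a ?b ?u ?v))"
    using R[of ?a ?b "?u + 1" "?v - 1"] by (simp add: D right_diff_distrib)
  have "k j > 0" "k (Suc j) > 0"
    using k j by auto
  then show ?thesis
    unfolding l1 l2 r1 r2 distrib_left[symmetric] using pair_duality[OF q] by simp
qed

section \<open>Both dualities from the bond relation\<close>

theorem proposition3p2:
  fixes q :: real and M :: nat and k :: "nat \<Rightarrow> real"
  assumes "0 < q" and "q < 1"
    and "\<forall>j\<in>{1..M}. k j > 0"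
  shows "duality_function (configs M)
           (ASIP_generator M q k) (ASIP_generator M (inverse q) k) (D_ASIP M q k)
       \<and> duality_function (configs M)
           (ASIP_generator M q k) (ASIP_generator M q k) (D_ASIP_tr M q k)"
proof -
  note q = assms(1)
  have "c_plus q k j \<eta> * (D_ASIP M q k (move j (j + 1) \<eta>) \<xi> - D_ASIP M q k \<eta> \<xi>)
        + c_minus q k (j + 1) \<eta> * (D_ASIP M q k (move (j + 1) j \<eta>) \<xi> - D_ASIP M q k \<eta> \<xi>)
      = c_plus (inverse q) k j \<xi> * (D_ASIP M q k \<eta> (move j (j + 1) \<xi>) - D_ASIP M q k \<eta> \<xi>)
        + c_minus (inverse q) k (j + 1) \<xi> * (D_ASIP M q k \<eta> (move (j + 1) j \<xi>) - D_ASIP M q k \<eta> \<xi>)"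
    if j: "j \<in> {1..<M}" for j \<eta> \<xi>
  proof -
    let ?x = "\<lambda>i. real (\<xi> i)"
    \<comment> \<open>\<open>move\<close> is a shift of \<open>?x\<close> only from an occupied
      site; from an empty one the rate is 0.\<close>
    have m1: "(\<lambda>i. real (move j (Suc j) \<xi> i)) = ?x(j := ?x j - 1, Suc j := ?x (Suc j) + 1)"
      if "\<xi> j \<noteq> 0" using that by (auto simp: move_alt fun_eq_iff)
    have m2: "(\<lambda>i. real (move (Suc j) j \<xi> i)) = ?x(j := ?x j + 1, Suc j := ?x (Suc j) - 1)"
      if "\<xi> (Suc j) \<noteq> 0" using that by (auto simp: move_alt fun_eq_iff)
    have c1: "c_plus (inverse q) k j \<xi>
        = q powr (- (?x j + k j - ?x (Suc j) - 1)) * q_number q (?x j) * q_number q (?x (Suc j) + k (Suc j))"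
      by (simp add: c_plus_def q_number_inverse[OF q] inverse_base_powr[OF q])
    have c2: "c_minus (inverse q) k (Suc j) \<xi>
        = q powr (?x (Suc j) + k (Suc j) - ?x j - 1) * q_number q (?x (Suc j)) * q_number q (?x j + k j)"
      by (simp add: c_minus_def q_number_inverse[OF q] inverse_base_powr[OF q])
    show ?thesis
      unfolding D_ASIP_eq_D_real[OF q] Suc_eq_plus1[symmetric] D_real_bond[OF assms j] c1 c2
    proof (rule arg_cong2[where f = "(+)"], goal_cases)
      case 1
      show ?case by (cases "\<xi> j = 0") (simp_all add: m1)
    next
      case 2
      show ?case by (cases "\<xi> (Suc j) = 0") (simp_all add: m2)
    qed
  qed
  moreover have "c_plus q k j \<eta> * (D_ASIP_tr M q k (move j (j + 1) \<eta>) \<xi> - D_ASIP_tr M q k \<eta> \<xi>)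
        + c_minus q k (j + 1) \<eta> * (D_ASIP_tr M q k (move (j + 1) j \<eta>) \<xi> - D_ASIP_tr M q k \<eta> \<xi>)
      = c_plus q k j \<xi> * (D_ASIP_tr M q k \<eta> (move j (j + 1) \<xi>) - D_ASIP_tr M q k \<eta> \<xi>)
        + c_minus q k (j + 1) \<xi> * (D_ASIP_tr M q k \<eta> (move (j + 1) j \<xi>) - D_ASIP_tr M q k \<eta> \<xi>)"
    if j: "j \<in> {1..<M}" for j \<eta> \<xi>
  proof -
    let ?x = "\<lambda>i. - real (\<xi> i) - k i"
    \<comment> \<open>Since \<open>?x\<close> contains \<open>- \<xi>\<close>, a particle leaving
      \<open>j\<close> raises \<open>?x j\<close>: the directions are exchanged.\<close>
    have m1: "(\<lambda>i. - real (move j (Suc j) \<xi> i) - k i) = ?x(j := ?x j + 1, Suc j := ?x (Suc j) - 1)"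
      if "\<xi> j \<noteq> 0" using that by (auto simp: move_alt fun_eq_iff)
    have m2: "(\<lambda>i. - real (move (Suc j) j \<xi> i) - k i) = ?x(j := ?x j - 1, Suc j := ?x (Suc j) + 1)"
      if "\<xi> (Suc j) \<noteq> 0" using that by (auto simp: move_alt fun_eq_iff)
    have n: "q_number q (- real (\<xi> i) - k i) = - q_number q (real (\<xi> i) + k i)" for i
      using q_number_minus[of q "real (\<xi> i) + k i"] by simp
    have n': "q_number q (- real (\<xi> i) - k i + k i) = - q_number q (real (\<xi> i))" for i
      by (simp add: q_number_minus)
    \<comment> \<open>The substitution swaps the roles of the two q-numbers, and their two signs
      cancel.\<close>
    have c1: "c_plus q k j \<xi>
        = q powr (?x (Suc j) + k (Suc j) - ?x j - 1) * q_number q (?x (Suc j)) * q_number q (?x j + k j)"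
      unfolding n n' c_plus_def by (simp add: algebra_simps)
    have c2: "c_minus q k (Suc j) \<xi>
        = q powr (- (?x j + k j - ?x (Suc j) - 1)) * q_number q (?x j) * q_number q (?x (Suc j) + k (Suc j))"
      unfolding n n' c_minus_def by (simp add: algebra_simps)
    show ?thesis
      unfolding D_ASIP_tr_eq_D_real[OF q] Suc_eq_plus1[symmetric] D_real_bond[OF assms j] c1 c2
      \<comment> \<open>The exchanged directions pair the first summand with the second, so one side
        is swapped.\<close>
      unfolding add.commute[of "q powr (- (?x j + k j - ?x (Suc j) - 1)) * _ * _ * _"]
    proof (rule arg_cong2[where f = "(+)"], goal_cases)
      case 1
      show ?case by (cases "\<xi> j = 0") (simp_all add: m1)
    next
      case 2
      show ?case by (cases "\<xi> (Suc j) = 0") (simp_all add: m2)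
    qed
  qed
  ultimately show ?thesis
    unfolding duality_function_def ASIP_generator_def by (auto intro!: sum.cong)
qed

end
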